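(* Let $H$ be a factorial monoid and let $M\subset H$ be a submonoid such that $M^{\times}=H^{\times}$. The following conditions are equivalent: (i) for every $a\in H$ and $b\in\mathcal{S}(H)$: $a^2b\in M\Rightarrow a\in M$ and $ab\in M$; (ii) for every $n\geq 0$ and $s_0,s_1,\dots,s_n\in\mathcal{S}(H)$: if $s_0s_1^2s_2^{2^2}\cdots s_n^{2^n}\in M$, then $s_is_{i+1}s_{i+2}^{2}s_{i+3}^{2^2}\cdots s_n^{2^{n-i-1}}\in M$ for all $i=0,\dots,n-1$, and $s_n\in M$; (iii) for every $n\geq 1$ and $s_1,\dots,s_n\in\mathcal{S}(H)$ such that $s_i$ and $s_j$ are relatively prime in $H$ for all $i\neq j$: if $s_1s_2^2s_3^3\cdots s_n^n\in M$, then $s_n,\ s_{n-1}s_n,\ s_{n-2}s_{n-1}s_n,\ \dots,\ s_1s_2\cdots s_n\in M$; (iv) for every $n\geq 1$ and $s_1,\dots,s_n\in\mathcal{S}(H)$ such that $s_i\mid s_{i+1}$ in $H$ for $i=1,\dots,n-1$: if $s_1s_2\cdots s_n\in M$, then $s_1,s_2,\dots,s_n\in M$; (v) for every $a\in H$ and $b\in\mathcal{S}(H)$ such that $a\mid b^n$ in $H$ for some $n\geq 1$: $ab\in M\Rightarrow a\in M$ and $b\in M$.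
   Context: Monoid means commutative cancellative monoid (written multiplicatively). $H^{\times}$ denotes the group of invertible elements of $H$. A monoid is factorial if every non-invertible element is a finite product of atoms, uniquely up to order and invertible factors. An element $a\in H$ is square-free if it cannot be written as $a=b^2c$ with $b,c\in H$ and $b\notin H^{\times}$; $\mathcal{S}(H)$ denotes the set of square-free elements of $H$ (invertible elements are square-free). Two elements of $H$ are relatively prime in $H$ if they have no common non-invertible divisor in $H$. *)

theory Defs
  imports "HOL-Algebra.Divisibility" "HOL-Algebra.FiniteProduct"
begin

definition square_free :: "('a, 'b) monoid_scheme \<Rightarrow> 'a set"
  where "square_free H = {a \<in> carrier H.
    \<not> (\<exists>b\<in>carrier H. \<exists>c\<in>carrier H. b \<notin> Units H \<and> a = b [^]\<^bsub>H\<^esub> (2::nat) \<otimes>\<^bsub>H\<^esub> c)}"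

definition rel_prime :: "('a, 'b) monoid_scheme \<Rightarrow> 'a \<Rightarrow> 'a \<Rightarrow> bool"
  where "rel_prime H a b \<longleftrightarrow>
    \<not> (\<exists>d\<in>carrier H. d \<notin> Units H \<and> d divides\<^bsub>H\<^esub> a \<and> d divides\<^bsub>H\<^esub> b)"

text \<open>
  In the conditions below a finite sequence is a function on \<^typ>\<open>nat\<close>, of which only the
  values at the indicated indices matter.
\<close>

definition cond_i :: "('a, 'b) monoid_scheme \<Rightarrow> 'a set \<Rightarrow> bool"
  where "cond_i H M \<longleftrightarrow>
    (\<forall>a\<in>carrier H. \<forall>b\<in>square_free H.
      a [^]\<^bsub>H\<^esub> (2::nat) \<otimes>\<^bsub>H\<^esub> b \<in> M \<longrightarrow> a \<in> M \<and> a \<otimes>\<^bsub>H\<^esub> b \<in> M)"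

definition cond_ii :: "('a, 'b) monoid_scheme \<Rightarrow> 'a set \<Rightarrow> bool"
  where "cond_ii H M \<longleftrightarrow>
    (\<forall>(n::nat) (s :: nat \<Rightarrow> 'a).
      (\<forall>i\<in>{0..n}. s i \<in> square_free H) \<longrightarrow>
      (\<Otimes>\<^bsub>H\<^esub>j\<in>{0..n}. s j [^]\<^bsub>H\<^esub> ((2::nat) ^ j)) \<in> M \<longrightarrow>
      (\<forall>i\<in>{0..<n}. s i \<otimes>\<^bsub>H\<^esub>
        (\<Otimes>\<^bsub>H\<^esub>j\<in>{i+1..n}. s j [^]\<^bsub>H\<^esub> ((2::nat) ^ (j - i - 1))) \<in> M) \<and>
      s n \<in> M)"

definition cond_iii :: "('a, 'b) monoid_scheme \<Rightarrow> 'a set \<Rightarrow> bool"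
  where "cond_iii H M \<longleftrightarrow>
    (\<forall>(n::nat) (s :: nat \<Rightarrow> 'a).
      1 \<le> n \<longrightarrow>
      (\<forall>i\<in>{1..n}. s i \<in> square_free H) \<longrightarrow>
      (\<forall>i\<in>{1..n}. \<forall>j\<in>{1..n}. i \<noteq> j \<longrightarrow> rel_prime H (s i) (s j)) \<longrightarrow>
      (\<Otimes>\<^bsub>H\<^esub>j\<in>{1..n}. s j [^]\<^bsub>H\<^esub> j) \<in> M \<longrightarrow>
      (\<forall>k\<in>{1..n}. (\<Otimes>\<^bsub>H\<^esub>j\<in>{k..n}. s j) \<in> M))"

definition cond_iv :: "('a, 'b) monoid_scheme \<Rightarrow> 'a set \<Rightarrow> bool"
  where "cond_iv H M \<longleftrightarrow>
    (\<forall>(n::nat) (s :: nat \<Rightarrow> 'a).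
      1 \<le> n \<longrightarrow>
      (\<forall>i\<in>{1..n}. s i \<in> square_free H) \<longrightarrow>
      (\<forall>i\<in>{1..<n}. s i divides\<^bsub>H\<^esub> s (i + 1)) \<longrightarrow>
      (\<Otimes>\<^bsub>H\<^esub>j\<in>{1..n}. s j) \<in> M \<longrightarrow>
      (\<forall>i\<in>{1..n}. s i \<in> M))"

definition cond_v :: "('a, 'b) monoid_scheme \<Rightarrow> 'a set \<Rightarrow> bool"
  where "cond_v H M \<longleftrightarrow>
    (\<forall>a\<in>carrier H. \<forall>b\<in>square_free H.
      (\<exists>n::nat. 1 \<le> n \<and> a divides\<^bsub>H\<^esub> (b [^]\<^bsub>H\<^esub> n)) \<longrightarrow>
      a \<otimes>\<^bsub>H\<^esub> b \<in> M \<longrightarrow> a \<in> M \<and> b \<in> M)"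

end

theory Submission
  imports Defs
begin

text \<open>
  Up to units an element of \<open>H\<close> is the function sending each class of atoms to its multiplicity,
  so \<open>M\<close> becomes a set \<open>N\<close> of bounded \<open>nat\<close>-valued functions that is closed under addition.
  Conditions (i) and (ii) both say that \<open>N\<close> is closed under \<open>f \<mapsto> \<lfloor>f/2\<rfloor>\<close> and \<open>f \<mapsto> \<lceil>f/2\<rceil>\<close>;
  (iii) and (iv) say that \<open>N\<close> contains the indicators of the level sets \<open>{k \<le> f}\<close> for \<open>k \<ge> 1\<close>;
  (v) says that with \<open>f\<close> also the indicator of the support and its complement in \<open>f\<close> are in \<open>N\<close>.
  Summing level indicators gives the other two properties. Conversely, peeling off the support
  repeatedly yields all levels, and halving \<open>m\<close> times yields \<open>\<lfloor>(f + i)/2^m\<rfloor>\<close> for all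
  \<open>i < 2^m\<close>, which for \<open>f \<le> 2^m\<close> and \<open>i = 2^m - k\<close> is the indicator of \<open>{k \<le> f}\<close>.
\<close>

section \<open>Sets of bounded functions\<close>

lemma div_power_Suc: "y div b ^ Suc m = y div b ^ m div b" for b y :: nat
  by (simp only: power_Suc2 div_mult2_eq)

text \<open>The \<open>k \<ge> 1\<close> that are counted form an initial segment ending at the half
  in question. This writes both halves of a bounded function as sums of level indicators, over even
  and over odd levels.\<close>

lemma half_sums:
  "y div 2 = (\<Sum>k=1..m. of_bool (2 * k \<le> y))"
  "(y + 1) div 2 = (\<Sum>k=1..m. of_bool (2 * k - 1 \<le> y))" if "y \<le> m" for y m :: nat
proof -
  have "(\<Sum>k=1..m. of_bool (2 * k \<le> y)) = card ({1..m} \<inter> {k. 2 * k \<le> y})"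
    by simp
  also have "{1..m} \<inter> {k. 2 * k \<le> y} = {1..y div 2}" using that by auto
  finally show "y div 2 = (\<Sum>k=1..m. of_bool (2 * k \<le> y))" by simp
  have "(\<Sum>k=1..m. of_bool (2 * k - 1 \<le> y)) = card ({1..m} \<inter> {k. 2 * k - 1 \<le> y})"
    by simp
  also have "{1..m} \<inter> {k. 2 * k - 1 \<le> y} = {1..(y + 1) div 2}" using that by auto
  finally show "(y + 1) div 2 = (\<Sum>k=1..m. of_bool (2 * k - 1 \<le> y))" by simp
qed

text \<open>One step of Horner's rule.\<close>

lemma binary_tail_Suc:
  fixes s :: "nat \<Rightarrow> nat"
  assumes "i \<le> n"
  shows "(\<Sum>j=i..n. 2 ^ (j - i) * s j) = s i + 2 * (\<Sum>j=Suc i..n. 2 ^ (j - Suc i) * s j)"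
proof -
  have "(\<Sum>j=i..n. 2 ^ (j - i) * s j) = s i + (\<Sum>j=Suc i..n. 2 ^ (j - i) * s j)"
    using assms by (simp add: sum.atLeast_Suc_atMost)
  also have "(\<Sum>j=Suc i..n. 2 ^ (j - i) * s j) = (\<Sum>j=Suc i..n. 2 * (2 ^ (j - Suc i) * s j))"
    by (rule sum.cong) (auto simp: Suc_diff_le simp flip: power_Suc mult.assoc)
  finally show ?thesis by (simp add: sum_distrib_left)
qed

text \<open>Downward induction along Horner's rule, starting from the empty sum at
  \<open>Suc n\<close>: the digits from place \<open>i\<close> on recombine to the quotient by
  \<open>2 ^ i\<close>.\<close>

lemma binary_tail_digits:
  fixes y :: nat
  assumes "y < 2 ^ Suc n" "i \<le> Suc n"
  shows "(\<Sum>j=i..n. 2 ^ (j - i) * (y div 2 ^ j mod 2)) = y div 2 ^ i"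
  using assms(2)
proof (induction i rule: inc_induct)
  case base
  then show ?case using assms(1) by simp
next
  case (step i)
  then have "(\<Sum>j=i..n. 2 ^ (j - i) * (y div 2 ^ j mod 2)) = y div 2 ^ i mod 2 + 2 * (y div 2 ^ Suc i)"
    using binary_tail_Suc[of i n "\<lambda>j. y div 2 ^ j mod 2"] by simp
  also have "y div 2 ^ Suc i = y div 2 ^ i div 2"
    by (rule div_power_Suc)
  finally show ?case by simp
qed

section \<open>Closure under halving, level indicators and peeling\<close>

definition level :: "nat \<Rightarrow> ('x \<Rightarrow> nat) \<Rightarrow> 'x \<Rightarrow> nat"
  where "level k f = (\<lambda>x. of_bool (k \<le> f x))"

definition half_closed :: "('x \<Rightarrow> nat) set \<Rightarrow> bool"
  where "half_closed N \<longleftrightarrow> (\<forall>f\<in>N. (\<lambda>x. f x div 2) \<in> N \<and> (\<lambda>x. (f x + 1) div 2) \<in> N)"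

definition level_closed :: "('x \<Rightarrow> nat) set \<Rightarrow> bool"
  where "level_closed N \<longleftrightarrow> (\<forall>f\<in>N. \<forall>k\<ge>1. level k f \<in> N)"

text \<open>Subtraction on \<open>nat\<close> truncates at 0, so \<open>f x - 1\<close> is
  \<open>f\<close> minus the indicator of its support.\<close>

definition peel_closed :: "('x \<Rightarrow> nat) set \<Rightarrow> bool"
  where "peel_closed N \<longleftrightarrow> (\<forall>f\<in>N. level 1 f \<in> N \<and> (\<lambda>x. f x - 1) \<in> N)"

locale bounded_function_monoid =
  fixes N :: "('x \<Rightarrow> nat) set"
  assumes zero_mem: "(\<lambda>_. 0) \<in> N"
    and add_mem: "\<lbrakk>f \<in> N; g \<in> N\<rbrakk> \<Longrightarrow> (\<lambda>x. f x + g x) \<in> N"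
    and bounded: "f \<in> N \<Longrightarrow> \<exists>m. \<forall>x. f x \<le> m"
begin

lemma sum_mem:
  assumes "finite A" "\<And>i. i \<in> A \<Longrightarrow> g i \<in> N"
  shows "(\<lambda>x. \<Sum>i\<in>A. g i x) \<in> N"
  using assms by (induction A rule: finite_induct) (auto intro: zero_mem add_mem)

lemma half_closed_imp_level_closed:
  assumes "half_closed N"
  shows "level_closed N"
  unfolding level_closed_def
proof (intro ballI allI impI)
  fix f and k :: nat assume f: "f \<in> N" and k: "1 \<le> k"
  have shift: "(\<lambda>x. (f x + i) div 2 ^ m) \<in> N" if "i < 2 ^ m" for i m :: nat
    using that
  proof (induction m arbitrary: i)
    case 0
    then show ?case using f by simp
  next
    case (Suc m)
    show ?case
    proof (cases "i < 2 ^ m")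
      \<comment> \<open>The leading binary digit of \<open>i\<close> decides how the last halving
        rounds: 0 means down, 1 means up.\<close>
      case True
      have "(\<lambda>x. (f x + i) div 2 ^ m div 2) \<in> N"
        using Suc.IH[OF True] assms by (auto simp: half_closed_def)
      then show ?thesis by (simp only: div_power_Suc)
    next
      case False
      then have "i - 2 ^ m < 2 ^ m" using Suc.prems by auto
      from Suc.IH[OF this] have "(\<lambda>x. ((f x + (i - 2 ^ m)) div 2 ^ m + 1) div 2) \<in> N"
        using assms by (auto simp: half_closed_def)
      \<comment> \<open>Rounding up adds 1 after the division by \<open>2 ^ m\<close>, which amounts
        to adding \<open>2 ^ m\<close> before it and so restores the leading digit of
        \<open>i\<close>.\<close>
      moreover have "((f x + (i - 2 ^ m)) div 2 ^ m + 1) div 2 = (f x + i) div 2 ^ Suc m" for x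
      proof -
        have "(f x + (i - 2 ^ m)) div 2 ^ m + 1 = (f x + (i - 2 ^ m) + 2 ^ m) div 2 ^ m"
          by (subst div_add_self2) auto
        also have "f x + (i - 2 ^ m) + 2 ^ m = f x + i" using False by simp
        finally show ?thesis by (simp only: div_power_Suc)
      qed
      ultimately show ?thesis by simp
    qed
  qed
  obtain m where m: "\<And>x. f x \<le> m" using bounded[OF f] by blast
  have m2: "f x < 2 ^ m" for x
    using m[of x] less_exp[of m] by linarith
  show "level k f \<in> N"
  proof (cases "k \<le> 2 ^ m")
    case True
    have "(\<lambda>x. (f x + (2 ^ m - k)) div 2 ^ m) \<in> N"
      by (rule shift) (use k in auto)
    moreover have "(f x + (2 ^ m - k)) div 2 ^ m = level k f x" for x
    proof (cases "k \<le> f x")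
      case T: True
      have "(f x + (2 ^ m - k)) div 2 ^ m = (f x - k + 2 ^ m) div 2 ^ m"
        using T True by (simp add: algebra_simps)
      also have "\<dots> = 1" using m2[of x] by (subst div_add_self2) auto
      finally show ?thesis using T by (simp add: level_def)
    next
      case False
      then show ?thesis using True by (simp add: level_def)
    qed
    ultimately show ?thesis by (simp add: level_def)
  next
    case False
    \<comment> \<open>A threshold above \<open>2 ^ m\<close> exceeds every value of
      \<open>f\<close>.\<close>
    then have "level k f = (\<lambda>_. 0)" using m2
      by (auto simp: level_def fun_eq_iff not_le intro: less_trans)
    then show ?thesis using zero_mem by simp
  qed
qed

lemma level_closed_imp_half_closed:
  assumes "level_closed N"
  shows "half_closed N"
  unfolding half_closed_def
proof
  fix f assume f: "f \<in> N"
  obtain m where m: "\<And>x. f x \<le> m" using bounded[OF f] by blast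
  have "(\<lambda>x. \<Sum>k=1..m. level (2 * k) f x) \<in> N" "(\<lambda>x. \<Sum>k=1..m. level (2 * k - 1) f x) \<in> N"
    by (rule sum_mem; use assms f in \<open>auto simp: level_closed_def\<close>)+
  then show "(\<lambda>x. f x div 2) \<in> N \<and> (\<lambda>x. (f x + 1) div 2) \<in> N"
    unfolding half_sums[OF m] by (simp add: level_def)
qed

lemma half_closed_iff_level_closed: "half_closed N \<longleftrightarrow> level_closed N"
  using half_closed_imp_level_closed level_closed_imp_half_closed by blast

lemma level_closed_iff_peel_closed: "level_closed N \<longleftrightarrow> peel_closed N"
proof
  assume L: "level_closed N"
  show "peel_closed N" unfolding peel_closed_def
  proof (intro ballI conjI)
    fix f assume f: "f \<in> N"
    show "level 1 f \<in> N" using L f by (simp add: level_closed_def)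
    obtain m where m: "\<And>x. f x \<le> m" using bounded[OF f] by blast
    \<comment> \<open>All levels from 1 on sum to \<open>f\<close>; dropping the first one removes
      the indicator of the support.\<close>
    have "(\<lambda>x. \<Sum>k=2..m. level k f x) \<in> N"
      by (rule sum_mem; use L f in \<open>auto simp: level_closed_def\<close>)
    moreover have "(\<Sum>k=2..m. level k f x) = f x - 1" for x
    proof -
      have "(\<Sum>k=2..m. level k f x) = card ({2..m} \<inter> {k. k \<le> f x})"
        by (simp add: level_def)
      also have "{2..m} \<inter> {k. k \<le> f x} = {2..f x}" using m[of x] by auto
      finally show ?thesis by simp
    qed
    ultimately show "(\<lambda>x. f x - 1) \<in> N" by simp
  qed
next
  assume P: "peel_closed N"
  have peel: "(\<lambda>x. f x - i) \<in> N" if "f \<in> N" for f i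
  proof (induction i)
    case (Suc i)
    then show ?case using P by (auto simp: peel_closed_def dest!: bspec)
  qed (use that in simp)
  show "level_closed N" unfolding level_closed_def
  proof (intro ballI allI impI)
    fix f and k :: nat assume "f \<in> N" "1 \<le> k"
    then have "level 1 (\<lambda>x. f x - (k - 1)) \<in> N"
      using P peel unfolding peel_closed_def by blast
    \<comment> \<open>After \<open>k - 1\<close> peelings, what is left is positive exactly where
      \<open>f\<close> was at least \<open>k\<close>.\<close>
    moreover have "level 1 (\<lambda>x. f x - (k - 1)) = level k f"
      using \<open>1 \<le> k\<close> by (auto simp: level_def fun_eq_iff)
    ultimately show "level k f \<in> N" by simp
  qed
qed

end

section \<open>Multiplicities in a factorial monoid\<close>

context factorial_monoid
begin

text \<open>The argument of the resulting function is an associate class. The choice of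
  factorization is immaterial by uniqueness, which is what \<open>multiplicity_wfactors\<close>
  records.\<close>

definition multiplicity :: "'a \<Rightarrow> 'a set \<Rightarrow> nat"
  where "multiplicity a = count (fmset G (SOME fs. set fs \<subseteq> carrier G \<and> wfactors G fs a))"

lemma multiplicity_wfactors:
  assumes "a \<in> carrier G" "set fs \<subseteq> carrier G" "wfactors G fs a"
  shows "multiplicity a = count (fmset G fs)"
proof -
  let ?gs = "SOME fs. set fs \<subseteq> carrier G \<and> wfactors G fs a"
  have "set ?gs \<subseteq> carrier G \<and> wfactors G ?gs a"
    by (rule someI_ex) (use assms in blast)
  then have "essentially_equal G ?gs fs"
    using assms wfactors_unique by blast
  then have "fmset G ?gs = fmset G fs"
    using \<open>set ?gs \<subseteq> carrier G \<and> wfactors G ?gs a\<close> assms(2) ee_fmset by blast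
  then show ?thesis by (simp add: multiplicity_def)
qed

section \<open>Additivity of multiplicities, and divisibility as the pointwise order\<close>

lemma multiplicity_mult:
  assumes "a \<in> carrier G" "b \<in> carrier G"
  shows "multiplicity (a \<otimes> b) x = multiplicity a x + multiplicity b x"
proof -
  obtain as bs where "set as \<subseteq> carrier G" "wfactors G as a" "set bs \<subseteq> carrier G" "wfactors G bs b"
    using assms wfactors_exist by meson
  then show ?thesis using assms
    by (simp add: multiplicity_wfactors[of a as] multiplicity_wfactors[of b bs]
        multiplicity_wfactors[of "a \<otimes> b" "as @ bs"] wfactors_mult fmset_def)
qed

lemma multiplicity_one: "multiplicity \<one> x = 0"
  using multiplicity_wfactors[of \<one> "[]"] by (simp add: fmset_def)

lemma multiplicity_pow:
  "a \<in> carrier G \<Longrightarrow> multiplicity (a [^] (n::nat)) x = n * multiplicity a x"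
  by (induction n) (simp_all add: multiplicity_one multiplicity_mult)

lemma multiplicity_finprod:
  assumes "finite A" "\<And>i. i \<in> A \<Longrightarrow> f i \<in> carrier G"
  shows "multiplicity (finprod G f A) x = (\<Sum>i\<in>A. multiplicity (f i) x)"
  using assms
  by (induction A rule: finite_induct) (auto simp: multiplicity_one multiplicity_mult Pi_def)

lemma multiplicity_finprod_pow:
  assumes "finite A" "\<And>i. i \<in> A \<Longrightarrow> f i \<in> carrier G"
  shows "multiplicity (\<Otimes>i\<in>A. f i [^] (e i :: nat)) x = (\<Sum>i\<in>A. e i * multiplicity (f i) x)"
  using assms by (subst multiplicity_finprod) (auto simp: multiplicity_pow intro!: sum.cong)

lemma divides_iff_multiplicity:
  assumes "a \<in> carrier G" "b \<in> carrier G"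
  shows "a divides b \<longleftrightarrow> (\<forall>x. multiplicity a x \<le> multiplicity b x)"
proof -
  obtain as bs where "set as \<subseteq> carrier G" "wfactors G as a" "set bs \<subseteq> carrier G" "wfactors G bs b"
    using assms wfactors_exist by meson
  then show ?thesis using assms
    by (simp add: multiplicity_wfactors[of a as] multiplicity_wfactors[of b bs]
        divides_as_fmsubset[of as a bs b] subseteq_mset_def)
qed

lemma unit_iff_multiplicity:
  assumes "a \<in> carrier G"
  shows "a \<in> Units G \<longleftrightarrow> (\<forall>x. multiplicity a x = 0)"
  using assms by (simp add: Unit_eq_dividesone divides_iff_multiplicity multiplicity_one)

lemma multiplicity_bounded: "\<exists>m. \<forall>x. multiplicity a x \<le> m"
  unfolding multiplicity_def by (meson count_le_size)

text \<open>Support inside that of an actual element makes \<open>f\<close> a finite multiset and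
  ensures that only classes of irreducible elements occur in it, so it can be multiplied
  out.\<close>

lemma multiplicity_exists:
  assumes "a \<in> carrier G" "\<And>x. 0 < f x \<Longrightarrow> 0 < multiplicity a x"
  shows "\<exists>c\<in>carrier G. multiplicity c = f"
proof -
  obtain as where as: "set as \<subseteq> carrier G" "wfactors G as a"
    using assms wfactors_exist by meson
  have a: "multiplicity a = count (fmset G as)"
    using assms as by (simp add: multiplicity_wfactors)
  have "finite {x. 0 < f x}"
    by (rule finite_subset[of _ "set_mset (fmset G as)"]) (use assms a in auto)
  then have f: "count (Abs_multiset f) = f" by simp
  have "\<exists>c cs. c \<in> carrier G \<and> set cs \<subseteq> carrier G \<and> wfactors G cs c \<and> fmset G cs = Abs_multiset f"
  proof (rule mset_wfactorsEx)
    fix X assume "X \<in># Abs_multiset f"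
    then have "0 < f X" using f by (metis count_greater_zero_iff)
    then have "X \<in># fmset G as" using assms a by auto
    then obtain x where "x \<in> set as" "X = assocs G x" by (auto simp: fmset_def)
    then show "\<exists>x. (x \<in> carrier G \<and> irreducible G x) \<and> X = assocs G x"
      using as by (auto elim!: wfactorsE)
  qed
  then show ?thesis using f by (metis multiplicity_wfactors)
qed

text \<open>A class of multiplicity at least 2 supplies an irreducible whose square divides;
  conversely the square of a non-unit contributes at least 2 at some class.\<close>

lemma square_free_iff:
  "square_free G = {a \<in> carrier G. \<forall>x. multiplicity a x \<le> 1}"
proof (intro subset_antisym subsetI)
  fix a assume a: "a \<in> square_free G"
  then have ac: "a \<in> carrier G" unfolding square_free_def by blast
  have "multiplicity a x \<le> 1" for x
  proof (rule ccontr)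
    assume x: "\<not> multiplicity a x \<le> 1"
    \<comment> \<open>\<open>b\<close> is a representative of the class \<open>x\<close>: its
      multiplicity function is the point mass there.\<close>
    obtain b where b: "b \<in> carrier G" "multiplicity b = (\<lambda>y. of_bool (y = x))"
      using multiplicity_exists[OF ac, of "\<lambda>y. of_bool (y = x)"] x by auto
    have "b [^] (2::nat) divides a"
      using x ac b by (subst divides_iff_multiplicity) (auto simp: multiplicity_pow)
    then obtain c where "c \<in> carrier G" "a = b [^] (2::nat) \<otimes> c" by (rule dividesE)
    moreover have "b \<notin> Units G" using b by (simp add: unit_iff_multiplicity)
    ultimately show False using a b(1) unfolding square_free_def by blast
  qed
  then show "a \<in> {a \<in> carrier G. \<forall>x. multiplicity a x \<le> 1}" using ac by blast
next
  fix a assume a: "a \<in> {a \<in> carrier G. \<forall>x. multiplicity a x \<le> 1}"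
  show "a \<in> square_free G" unfolding square_free_def
  proof (intro CollectI conjI notI)
    show "a \<in> carrier G" using a by simp
    assume "\<exists>b\<in>carrier G. \<exists>c\<in>carrier G. b \<notin> Units G \<and> a = b [^] (2::nat) \<otimes> c"
    then obtain b c where bc: "b \<in> carrier G" "c \<in> carrier G" "b \<notin> Units G"
      "a = b [^] (2::nat) \<otimes> c" by blast
    then obtain x where "0 < multiplicity b x" by (auto simp: unit_iff_multiplicity)
    moreover have "multiplicity a x = 2 * multiplicity b x + multiplicity c x"
      using bc by (simp add: multiplicity_mult multiplicity_pow)
    moreover have "multiplicity a x \<le> 1" using a by simp
    ultimately show False by linarith
  qed
qed

text \<open>A class occurring in both elements has a representative that is a common non-unit
  divisor.\<close>

lemma rel_prime_iff:
  assumes "a \<in> carrier G" "b \<in> carrier G"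
  shows "rel_prime G a b \<longleftrightarrow> (\<forall>x. multiplicity a x = 0 \<or> multiplicity b x = 0)"
proof
  assume R: "rel_prime G a b"
  show "\<forall>x. multiplicity a x = 0 \<or> multiplicity b x = 0"
  proof (rule ccontr, clarsimp)
    fix x assume x: "0 < multiplicity a x" "0 < multiplicity b x"
    obtain d where d: "d \<in> carrier G" "multiplicity d = (\<lambda>y. of_bool (y = x))"
      using multiplicity_exists[OF assms(1), of "\<lambda>y. of_bool (y = x)"] x by auto
    then have "d divides a" "d divides b" "d \<notin> Units G"
      using x assms by (auto simp: divides_iff_multiplicity unit_iff_multiplicity Suc_le_eq)
    then show False using R d by (auto simp: rel_prime_def)
  qed
next
  assume "\<forall>x. multiplicity a x = 0 \<or> multiplicity b x = 0"
  then show "rel_prime G a b"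
    using assms unfolding rel_prime_def
    by (auto simp: divides_iff_multiplicity unit_iff_multiplicity) (metis le_zero_eq less_nat_zero_code)
qed

end

section \<open>The conditions in terms of multiplicities\<close>

locale factorial_monoid_submonoid = factorial_monoid G + submonoid M G for G (structure) and M +
  assumes Units_subset: "Units G \<subseteq> M"
begin

abbreviation N :: "('a set \<Rightarrow> nat) set"
  where "N \<equiv> multiplicity ` M"

section \<open>Membership in the submonoid read off multiplicities\<close>

lemma mem_carrier: "a \<in> M \<Longrightarrow> a \<in> carrier G"
  using subset by blast

lemma multiplicity_in_N: "\<lbrakk>a \<in> M; multiplicity a = f\<rbrakk> \<Longrightarrow> f \<in> N"
  by blast

text \<open>Equal multiplicities mean associated elements, and \<open>M\<close> absorbs the unit
  between them because it contains all units.\<close>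

lemma mem_iff_multiplicity:
  assumes "c \<in> carrier G"
  shows "c \<in> M \<longleftrightarrow> multiplicity c \<in> N"
proof
  assume "multiplicity c \<in> N"
  then obtain a where a: "a \<in> M" "multiplicity c = multiplicity a" by blast
  then have "c \<sim> a"
    using assms mem_carrier by (simp add: associated_def divides_iff_multiplicity)
  then obtain u where "u \<in> Units G" "c = a \<otimes> u"
    using assms a mem_carrier associatedD2 by blast
  then show "c \<in> M" using a Units_subset by auto
qed blast

sublocale N: bounded_function_monoid N
proof
  show "(\<lambda>_. 0) \<in> N"
    by (rule image_eqI[of _ _ \<one>]) (simp_all add: fun_eq_iff multiplicity_one)
next
  fix f g assume "f \<in> N" "g \<in> N"
  then obtain a b where ab: "a \<in> M" "b \<in> M" "f = multiplicity a" "g = multiplicity b" by blast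
  then have "(\<lambda>x. f x + g x) = multiplicity (a \<otimes> b)"
    by (simp add: fun_eq_iff multiplicity_mult mem_carrier)
  then show "(\<lambda>x. f x + g x) \<in> N" using ab by blast
next
  fix f assume "f \<in> N"
  then show "\<exists>m. \<forall>x. f x \<le> m" using multiplicity_bounded by blast
qed

lemma exists_below:
  assumes "f \<in> N" "\<And>x. f x = 0 \<Longrightarrow> g x = 0"
  shows "\<exists>c\<in>carrier G. multiplicity c = g"
proof -
  obtain a where "a \<in> M" "f = multiplicity a" using assms by blast
  then show ?thesis using multiplicity_exists[of a g] assms mem_carrier by force
qed

lemma exists_square_free_below:
  assumes "f \<in> N" "\<And>i x. f x = 0 \<Longrightarrow> g i x = 0" "\<And>i x. g i x \<le> 1"
  obtains s where "\<And>i. s i \<in> square_free G" "\<And>i. s i \<in> carrier G" "\<And>i. multiplicity (s i) = g i"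
proof -
  have "\<exists>c\<in>carrier G. multiplicity c = g i" for i
    using exists_below[OF assms(1), of "g i"] assms(2) by blast
  then obtain s where "\<And>i. s i \<in> carrier G \<and> multiplicity (s i) = g i" by metis
  then show ?thesis
    by (intro that[of s]) (use assms(3) in \<open>simp_all add: square_free_iff\<close>)
qed

section \<open>Each condition as a closure property\<close>

lemma square_freeD:
  assumes "a \<in> square_free G"
  shows "a \<in> carrier G" "multiplicity a x \<le> 1"
  using assms by (simp_all add: square_free_iff)

text \<open>With \<open>b\<close> square-free, \<open>a^2 b\<close> is division by 2 with remainder
  at every class: \<open>a\<close> is the floor of the half, and \<open>a b\<close> the
  ceiling.\<close>

lemma cond_i_iff: "cond_i G M \<longleftrightarrow> half_closed N"
proof
  assume C: "cond_i G M"
  show "half_closed N" unfolding half_closed_def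
  proof
    fix f assume f: "f \<in> N"
    obtain a where a: "a \<in> carrier G" "multiplicity a = (\<lambda>x. f x div 2)"
      using exists_below[OF f, of "\<lambda>x. f x div 2"] by auto
    obtain b where b: "b \<in> carrier G" "multiplicity b = (\<lambda>x. f x mod 2)"
      using exists_below[OF f, of "\<lambda>x. f x mod 2"] by auto
    have "multiplicity (a [^] (2::nat) \<otimes> b) = f"
      using a b by (simp add: fun_eq_iff multiplicity_mult multiplicity_pow)
    then have "a [^] (2::nat) \<otimes> b \<in> M" using f a b by (simp add: mem_iff_multiplicity)
    moreover have "f x mod 2 \<le> 1" for x by linarith
    then have "b \<in> square_free G" using b by (simp add: square_free_iff)
    ultimately have "a \<in> M" "a \<otimes> b \<in> M" using C a(1) unfolding cond_i_def by blast+
    moreover have "multiplicity (a \<otimes> b) = (\<lambda>x. (f x + 1) div 2)"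
      using a b by (auto simp: fun_eq_iff multiplicity_mult) presburger
    ultimately show "(\<lambda>x. f x div 2) \<in> N \<and> (\<lambda>x. (f x + 1) div 2) \<in> N"
      using a multiplicity_in_N by blast
  qed
next
  assume H: "half_closed N"
  show "cond_i G M" unfolding cond_i_def
  proof (intro ballI impI)
    fix a b assume a: "a \<in> carrier G" and b: "b \<in> square_free G"
      and m: "a [^] (2::nat) \<otimes> b \<in> M"
    let ?f = "multiplicity (a [^] (2::nat) \<otimes> b)"
    have "?f x div 2 = multiplicity a x" "(?f x + 1) div 2 = multiplicity (a \<otimes> b) x" for x
      using a square_freeD(1)[OF b] square_freeD(2)[OF b, of x] by (auto simp: multiplicity_mult multiplicity_pow)
    then have "multiplicity a \<in> N" "multiplicity (a \<otimes> b) \<in> N"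
      using H m by (auto simp: half_closed_def)
    then show "a \<in> M \<and> a \<otimes> b \<in> M"
      using a square_freeD(1)[OF b] mem_iff_multiplicity by blast
  qed
qed

text \<open>For square-free factors the right-hand side is the ceiling of half the binary tail
  starting at \<open>i\<close>.\<close>

lemma multiplicity_shifted_product:
  assumes "\<And>j. j \<in> {Suc i..n} \<Longrightarrow> s j \<in> carrier G" "s i \<in> carrier G"
  shows "multiplicity (s i \<otimes> (\<Otimes>j\<in>{i+1..n}. s j [^] ((2::nat) ^ (j - i - 1)))) x =
    multiplicity (s i) x + (\<Sum>j=Suc i..n. 2 ^ (j - Suc i) * multiplicity (s j) x)"
  using assms
  by (subst multiplicity_mult, simp, simp add: Pi_def, subst multiplicity_finprod_pow) auto

text \<open>The multiplicities of the \<open>s j\<close> are the binary digits of \<open>f\<close>.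
  The elements in the conclusion are the rounded-up halves of the successive quotients of
  \<open>f\<close> by powers of 2, together with the top digit.\<close>

lemma cond_ii_iff: "cond_ii G M \<longleftrightarrow> half_closed N"
proof
  assume C: "cond_ii G M"
  show "half_closed N" unfolding half_closed_def
  proof
    fix f assume f: "f \<in> N"
    obtain n0 where n0: "\<And>x. f x \<le> n0" using N.bounded[OF f] by blast
    \<comment> \<open>The successor makes \<open>n\<close> positive, so that index 0 is covered by
      the conclusion and \<open>q 1\<close> is available below.\<close>
    define n where "n = Suc n0"
    have n: "f x < 2 ^ Suc n" for x
      using n0[of x] less_exp[of "Suc n"] by (simp add: n_def)
    define q where "q i x = f x div 2 ^ i" for i x
    obtain s where s: "\<And>i. s i \<in> square_free G" "\<And>i. s i \<in> carrier G"
      "\<And>i. multiplicity (s i) = (\<lambda>x. f x div 2 ^ i mod 2)"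
      by (rule exists_square_free_below[OF f, of "\<lambda>i x. f x div 2 ^ i mod 2"]) auto
    have "multiplicity (\<Otimes>j\<in>{0..n}. s j [^] ((2::nat) ^ j)) = f"
      using s(2) binary_tail_digits[OF n, of 0]
      by (simp add: fun_eq_iff multiplicity_finprod_pow s(3))
    then have "(\<Otimes>j\<in>{0..n}. s j [^] ((2::nat) ^ j)) \<in> M"
      using f s(2) by (simp add: mem_iff_multiplicity)
    then have concl: "(\<forall>i\<in>{0..<n}. s i \<otimes> (\<Otimes>j\<in>{i+1..n}. s j [^] ((2::nat) ^ (j - i - 1))) \<in> M) \<and>
        s n \<in> M"
      using C s(1) unfolding cond_ii_def by blast
    then have tail: "s i \<otimes> (\<Otimes>j\<in>{i+1..n}. s j [^] ((2::nat) ^ (j - i - 1))) \<in> M" if "i < n" for i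
      using that by auto
    have top: "s n \<in> M" using concl by blast
    have ceil: "(\<lambda>x. (f x div 2 ^ i mod 2) + q (Suc i) x) \<in> N" if "i < n" for i
    proof -
      have "multiplicity (s i \<otimes> (\<Otimes>j\<in>{i+1..n}. s j [^] ((2::nat) ^ (j - i - 1)))) =
          (\<lambda>x. (f x div 2 ^ i mod 2) + q (Suc i) x)"
        using s(2) that
        by (intro ext, subst multiplicity_shifted_product)
          (simp_all add: s(3) binary_tail_digits[OF n] q_def del: power_Suc)
      then show ?thesis by (rule multiplicity_in_N[OF tail[OF that]])
    qed
    \<comment> \<open>The condition yields ceilings and the top digit only. The floors are recovered
      from the top down, since \<open>q i\<close> is its rounded-up half plus its rounded-down half
      \<open>q (Suc i)\<close>.\<close>
    have q: "q i \<in> N" if "i \<le> n" for i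
      using that
    proof (induction i rule: inc_induct)
      case base
      have "multiplicity (s n) = q n"
        using n by (auto simp: s(3) q_def fun_eq_iff less_mult_imp_div_less)
      then show ?case by (rule multiplicity_in_N[OF top])
    next
      case (step i)
      have "q i x = (f x div 2 ^ i mod 2) + q (Suc i) x + q (Suc i) x" for x
        using div_mult_mod_eq[of "f x div 2 ^ i" 2] unfolding q_def div_power_Suc by linarith
      then have "q i = (\<lambda>x. (f x div 2 ^ i mod 2) + q (Suc i) x + q (Suc i) x)" by blast
      then show ?case using N.add_mem[OF ceil step.IH] step.hyps by simp
    qed
    have "(\<lambda>x. f x div 2) \<in> N" using q[of 1] by (simp add: n_def q_def[abs_def])
    moreover have "(f x div 2 ^ 0 mod 2) + q (Suc 0) x = (f x + 1) div 2" for x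
      unfolding q_def by simp presburger
    then have "(\<lambda>x. (f x + 1) div 2) \<in> N" using ceil[of 0] by (simp add: n_def)
    ultimately show "(\<lambda>x. f x div 2) \<in> N \<and> (\<lambda>x. (f x + 1) div 2) \<in> N" by blast
  qed
next
  assume H: "half_closed N"
  show "cond_ii G M" unfolding cond_ii_def
  proof (intro allI impI)
    fix n :: nat and s :: "nat \<Rightarrow> 'a"
    assume sf: "\<forall>i\<in>{0..n}. s i \<in> square_free G"
      and m: "(\<Otimes>j\<in>{0..n}. s j [^] ((2::nat) ^ j)) \<in> M"
    have s: "s i \<in> carrier G" "multiplicity (s i) x \<le> 1" if "i \<le> n" for i x
      using square_freeD sf that by auto
    \<comment> \<open>\<open>q i\<close> is the tail of the binary expansion from place
      \<open>i\<close>; halving it drops one digit.\<close>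
    define q where "q i x = (\<Sum>j=i..n. 2 ^ (j - i) * multiplicity (s j) x)" for i x
    have q_Suc: "q i x = multiplicity (s i) x + 2 * q (Suc i) x" if "i \<le> n" for i x
      unfolding q_def by (rule binary_tail_Suc[OF that])
    have half: "q i x div 2 = q (Suc i) x"
      "(q i x + 1) div 2 = multiplicity (s i) x + q (Suc i) x" if "i \<le> n" for i x
      using q_Suc[OF that, of x] s(2)[OF that, of x] by auto
    have q: "q i \<in> N" if "i \<le> n" for i
      using that
    proof (induction i)
      case 0
      have "multiplicity (\<Otimes>j\<in>{0..n}. s j [^] ((2::nat) ^ j)) = q 0"
        by (intro ext, subst multiplicity_finprod_pow) (use s(1) in \<open>auto simp: q_def\<close>)
      then show ?case by (rule multiplicity_in_N[OF m])
    next
      case (Suc i)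
      then have "q i \<in> N" by simp
      then have "(\<lambda>x. q i x div 2) \<in> N" using H unfolding half_closed_def by blast
      then show ?case using half(1)[of i] Suc by simp
    qed
    have "s i \<otimes> (\<Otimes>j\<in>{i+1..n}. s j [^] ((2::nat) ^ (j - i - 1))) \<in> M" if "i < n" for i
    proof -
      have "multiplicity (s i \<otimes> (\<Otimes>j\<in>{i+1..n}. s j [^] ((2::nat) ^ (j - i - 1)))) =
          (\<lambda>x. (q i x + 1) div 2)"
        using s(1) that half(2)[of i]
        by (intro ext, subst multiplicity_shifted_product) (auto simp: q_def)
      moreover have "(\<lambda>x. (q i x + 1) div 2) \<in> N"
        using H q[OF less_imp_le[OF that]] unfolding half_closed_def by blast
      ultimately show ?thesis
        using s(1) that by (subst mem_iff_multiplicity) (auto simp: Pi_def)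
    qed
    moreover have "s n \<in> M"
    proof -
      have "q n = multiplicity (s n)" by (simp add: q_def fun_eq_iff)
      then show ?thesis using q[OF order_refl] s(1)[OF order_refl] mem_iff_multiplicity by metis
    qed
    ultimately show "(\<forall>i\<in>{0..<n}. s i \<otimes> (\<Otimes>j\<in>{i+1..n}. s j [^] ((2::nat) ^ (j - i - 1))) \<in> M)
        \<and> s n \<in> M" by simp
  qed
qed

text \<open>Pairwise coprime square-free factors with exponents \<open>1..n\<close> amount to the
  partition of the support of \<open>f\<close> into the sets where \<open>f\<close> equals
  \<open>j\<close>; the product from \<open>k\<close> on is then the level indicator at
  \<open>k\<close>.\<close>

lemma cond_iii_iff: "cond_iii G M \<longleftrightarrow> level_closed N"
proof
  assume C: "cond_iii G M"
  show "level_closed N" unfolding level_closed_def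
  proof (intro ballI allI impI)
    fix f and k :: nat assume f: "f \<in> N" and k: "1 \<le> k"
    obtain n0 where n0: "\<And>x. f x \<le> n0" using N.bounded[OF f] by blast
    \<comment> \<open>The maximum with \<open>k\<close> puts \<open>k\<close> into the index range
      even when the level at \<open>k\<close> is empty.\<close>
    define n where "n = max n0 k"
    have n: "f x \<le> n" "k \<le> n" for x using n0[of x] by (auto simp: n_def)
    \<comment> \<open>The clause \<open>i \<noteq> 0\<close> keeps \<open>s 0\<close> supported
      inside \<open>f\<close>; index 0 does not enter the products.\<close>
    obtain s where s: "\<And>i. s i \<in> square_free G" "\<And>i. s i \<in> carrier G"
      "\<And>i. multiplicity (s i) = (\<lambda>x. of_bool (f x = i \<and> i \<noteq> 0))"
      by (rule exists_square_free_below[OF f, of "\<lambda>i x. of_bool (f x = i \<and> i \<noteq> 0)"]) auto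
    have "multiplicity (\<Otimes>j\<in>{1..n}. s j [^] j) x = f x" for x
    proof -
      have "multiplicity (\<Otimes>j\<in>{1..n}. s j [^] j) x = (\<Sum>j=1..n. if f x = j then j else 0)"
        using s(2) by (auto simp: multiplicity_finprod multiplicity_pow s(3) intro!: sum.cong)
      also have "\<dots> = f x" using n(1)[of x] by auto
      finally show ?thesis .
    qed
    then have "multiplicity (\<Otimes>j\<in>{1..n}. s j [^] j) = f" by blast
    then have "(\<Otimes>j\<in>{1..n}. s j [^] j) \<in> M" using f s(2) by (simp add: mem_iff_multiplicity)
    moreover have "\<forall>i\<in>{1..n}. \<forall>j\<in>{1..n}. i \<noteq> j \<longrightarrow> rel_prime G (s i) (s j)"
      using s(2) by (auto simp: rel_prime_iff s(3))
    moreover have "1 \<le> n" "k \<in> {1..n}" using k n by auto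
    ultimately have "(\<Otimes>j\<in>{k..n}. s j) \<in> M"
      using C s(1) unfolding cond_iii_def by blast
    moreover have "multiplicity (\<Otimes>j\<in>{k..n}. s j) x = level k f x" for x
    proof -
      have "multiplicity (\<Otimes>j\<in>{k..n}. s j) x = (\<Sum>j=k..n. if f x = j then 1 else 0)"
        using s(2) k by (auto simp: multiplicity_finprod s(3) intro!: sum.cong)
      also have "\<dots> = level k f x" using n(1)[of x] by (auto simp: level_def)
      finally show ?thesis .
    qed
    ultimately show "level k f \<in> N" by (rule multiplicity_in_N[OF _ ext])
  qed
next
  assume L: "level_closed N"
  show "cond_iii G M" unfolding cond_iii_def
  proof (intro allI impI ballI)
    fix n k :: nat and s :: "nat \<Rightarrow> 'a"
    assume sf: "\<forall>i\<in>{1..n}. s i \<in> square_free G"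
      and rp: "\<forall>i\<in>{1..n}. \<forall>j\<in>{1..n}. i \<noteq> j \<longrightarrow> rel_prime G (s i) (s j)"
      and m: "(\<Otimes>j\<in>{1..n}. s j [^] j) \<in> M" and k: "k \<in> {1..n}"
    have s: "s i \<in> carrier G" "multiplicity (s i) x \<le> 1" if "i \<in> {1..n}" for i x
      using square_freeD sf that by auto
    let ?f = "multiplicity (\<Otimes>j\<in>{1..n}. s j [^] j)"
    have f: "?f x = (\<Sum>j=1..n. j * multiplicity (s j) x)" for x
      by (rule multiplicity_finprod_pow) (use s(1) in auto)
    have g: "multiplicity (\<Otimes>j\<in>{k..n}. s j) x = (\<Sum>j=k..n. multiplicity (s j) x)" for x
      by (rule multiplicity_finprod) (use s(1) k in auto)
    have "multiplicity (\<Otimes>j\<in>{k..n}. s j) x = level k ?f x" for x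
    proof (cases "\<exists>i\<in>{1..n}. multiplicity (s i) x \<noteq> 0")
      case True
      then obtain i where i: "i \<in> {1..n}" "multiplicity (s i) x \<noteq> 0" by blast
      \<comment> \<open>By coprimality only one factor is nonzero at \<open>x\<close>, so its index
        is the value of \<open>?f\<close> there.\<close>
      have eq: "multiplicity (s j) x = (if j = i then 1 else 0)" if j: "j \<in> {1..n}" for j
      proof (cases "j = i")
        case True
        then show ?thesis using s(2)[OF i(1), of x] i(2) by simp
      next
        case False
        then have "rel_prime G (s j) (s i)" using rp i(1) j by blast
        then show ?thesis using i False j s(1) by (auto simp: rel_prime_iff)
      qed
      have "?f x = (\<Sum>j=1..n. if j = i then i else 0)"
        unfolding f by (rule sum.cong) (auto simp: eq)
      then have "?f x = i" using i by simp
      moreover have "(\<Sum>j=k..n. multiplicity (s j) x) = (\<Sum>j=k..n. if j = i then 1 else 0)"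
        by (rule sum.cong) (use k in \<open>auto simp: eq\<close>)
      ultimately show ?thesis using i unfolding g by (simp add: level_def)
    next
      case False
      then show ?thesis using k unfolding g level_def f by auto
    qed
    then have "multiplicity (\<Otimes>j\<in>{k..n}. s j) = level k ?f" by blast
    moreover have "level k ?f \<in> N" using L m k by (simp add: level_closed_def)
    ultimately show "(\<Otimes>j\<in>{k..n}. s j) \<in> M"
      using s(1) k by (subst mem_iff_multiplicity) (auto simp: Pi_def)
  qed
qed

text \<open>A divisor chain of square-free elements is the increasing family of level sets of its
  product, listed from the highest level \<open>n\<close> down to level 1.\<close>

lemma cond_iv_iff: "cond_iv G M \<longleftrightarrow> level_closed N"
proof
  assume C: "cond_iv G M"
  show "level_closed N" unfolding level_closed_def
  proof (intro ballI allI impI)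
    fix f and k :: nat assume f: "f \<in> N" and k: "1 \<le> k"
    obtain n0 where n0: "\<And>x. f x \<le> n0" using N.bounded[OF f] by blast
    define n where "n = max n0 k"
    have n: "f x \<le> n" "k \<le> n" for x using n0[of x] by (auto simp: n_def)
    \<comment> \<open>\<open>n < i + f x\<close> says that \<open>f x\<close> reaches level
      \<open>n + 1 - i\<close>. The clause \<open>f x \<noteq> 0\<close> confines \<open>s i\<close>
      to the support of \<open>f\<close> also for \<open>i > n\<close>.\<close>
    obtain s where s: "\<And>i. s i \<in> square_free G" "\<And>i. s i \<in> carrier G"
      "\<And>i. multiplicity (s i) = (\<lambda>x. of_bool (n < i + f x \<and> f x \<noteq> 0))"
      by (rule exists_square_free_below[OF f, of "\<lambda>i x. of_bool (n < i + f x \<and> f x \<noteq> 0)"]) auto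
    have "multiplicity (\<Otimes>j\<in>{1..n}. s j) x = f x" for x
    proof -
      have "multiplicity (\<Otimes>j\<in>{1..n}. s j) x = card ({1..n} \<inter> {j. n < j + f x \<and> f x \<noteq> 0})"
        using s(2) by (simp add: multiplicity_finprod s(3))
      also have "{1..n} \<inter> {j. n < j + f x \<and> f x \<noteq> 0} = {n - f x<..n}" using n(1)[of x] by auto
      finally show ?thesis using n(1)[of x] by simp
    qed
    then have "multiplicity (\<Otimes>j\<in>{1..n}. s j) = f" by blast
    then have "(\<Otimes>j\<in>{1..n}. s j) \<in> M" using f s(2) by (simp add: mem_iff_multiplicity)
    moreover have "\<forall>i\<in>{1..<n}. s i divides s (i + 1)"
      using s(2) by (auto simp: divides_iff_multiplicity s(3))
    moreover have "1 \<le> n" "n + 1 - k \<in> {1..n}" using k n by auto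
    ultimately have "s (n + 1 - k) \<in> M"
      using C s(1) unfolding cond_iv_def by blast
    moreover have "multiplicity (s (n + 1 - k)) = level k f"
      using k n(2) by (auto simp: s(3) level_def fun_eq_iff)
    ultimately show "level k f \<in> N" by (rule multiplicity_in_N)
  qed
next
  assume L: "level_closed N"
  show "cond_iv G M" unfolding cond_iv_def
  proof (intro allI impI ballI)
    fix n i :: nat and s :: "nat \<Rightarrow> 'a"
    assume sf: "\<forall>i\<in>{1..n}. s i \<in> square_free G"
      and dv: "\<forall>i\<in>{1..<n}. s i divides s (i + 1)"
      and m: "(\<Otimes>j\<in>{1..n}. s j) \<in> M" and i: "i \<in> {1..n}"
    have s: "s i \<in> carrier G" "multiplicity (s i) x \<le> 1" if "i \<in> {1..n}" for i x
      using square_freeD sf that by auto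
    have mono: "multiplicity (s j) x \<le> multiplicity (s l) x" if "j \<le> l" "1 \<le> j" "l \<le> n" for j l x
      using that
    proof (induction l rule: dec_induct)
      case (step l)
      then have "s l divides s (l + 1)" using dv by auto
      then have "multiplicity (s l) x \<le> multiplicity (s (Suc l)) x"
        using step s(1) by (simp add: divides_iff_multiplicity)
      then show ?case using step by simp
    qed simp
    let ?f = "multiplicity (\<Otimes>j\<in>{1..n}. s j)"
    have f: "?f x = (\<Sum>j=1..n. multiplicity (s j) x)" for x
      by (rule multiplicity_finprod) (use s(1) in auto)
    \<comment> \<open>At \<open>x\<close> the chain reads 0,...,0,1,...,1 and \<open>?f x\<close>
      counts the ones. Position \<open>i\<close> holds a one iff there are at least
      \<open>n + 1 - i\<close> of them.\<close>
    have "multiplicity (s i) x = level (n + 1 - i) ?f x" for x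
    proof (cases "multiplicity (s i) x = 0")
      case True
      have "?f x = (\<Sum>j\<in>{i<..n}. multiplicity (s j) x)"
        unfolding f
      proof (rule sum.mono_neutral_right)
        show "\<forall>j\<in>{1..n} - {i<..n}. multiplicity (s j) x = 0"
          using mono[of _ i x] True i by fastforce
      qed auto
      also have "\<dots> \<le> (\<Sum>j\<in>{i<..n}. 1)" by (rule sum_mono) (use s(2) in simp)
      finally show ?thesis using True i by (auto simp: level_def Suc_diff_le)
    next
      case False
      have "n + 1 - i = (\<Sum>j\<in>{i..n}. 1)" by simp
      also have "\<dots> \<le> (\<Sum>j\<in>{i..n}. multiplicity (s j) x)"
        by (rule sum_mono) (use mono[of i _ x] False i in \<open>fastforce\<close>)
      also have "\<dots> \<le> ?f x" unfolding f by (rule sum_mono2) (use i in auto)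
      finally show ?thesis using False s(2)[OF i, of x] by (simp add: level_def)
    qed
    then have "multiplicity (s i) = level (n + 1 - i) ?f" by blast
    moreover have "1 \<le> n + 1 - i" using i by auto
    then have "level (n + 1 - i) ?f \<in> N" using L m unfolding level_closed_def by blast
    ultimately show "s i \<in> M" using s(1) i by (simp add: mem_iff_multiplicity)
  qed
qed

text \<open>Dividing a power of \<open>b\<close> means having support inside that of
  \<open>b\<close>. Hence square-free \<open>b\<close> is the indicator of the support of
  \<open>a b\<close>, and \<open>a\<close> is what remains after peeling it off.\<close>

lemma cond_v_iff: "cond_v G M \<longleftrightarrow> peel_closed N"
proof
  assume C: "cond_v G M"
  show "peel_closed N" unfolding peel_closed_def
  proof
    fix f assume f: "f \<in> N"
    obtain n0 where n0: "\<And>x. f x \<le> n0" using N.bounded[OF f] by blast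
    \<comment> \<open>The successor provides the positive exponent that the condition asks for, even
      if \<open>f\<close> vanishes.\<close>
    define n where "n = Suc n0"
    have n: "f x \<le> n" for x using n0[of x] by (simp add: n_def)
    obtain a where a: "a \<in> carrier G" "multiplicity a = (\<lambda>x. f x - 1)"
      using exists_below[OF f, of "\<lambda>x. f x - 1"] by auto
    obtain b where b: "b \<in> carrier G" "multiplicity b = level 1 f"
      using exists_below[OF f, of "level 1 f"] by (auto simp: level_def)
    have "multiplicity (a \<otimes> b) = f"
      using a b by (auto simp: fun_eq_iff multiplicity_mult level_def)
    then have "a \<otimes> b \<in> M" using f a b by (simp add: mem_iff_multiplicity)
    moreover have "b \<in> square_free G" using b by (simp add: square_free_iff level_def)
    moreover have "a divides b [^] n"
    proof -
      have "f x - 1 \<le> n * level 1 f x" for x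
        using n[of x] by (cases "f x = 0") (auto simp: level_def)
      then show ?thesis
        using a b by (simp add: divides_iff_multiplicity multiplicity_pow)
    qed
    moreover have "1 \<le> n" by (simp add: n_def)
    ultimately have "a \<in> M" "b \<in> M" using C a(1) unfolding cond_v_def by blast+
    then show "level 1 f \<in> N \<and> (\<lambda>x. f x - 1) \<in> N" using a b multiplicity_in_N by blast
  qed
next
  assume P: "peel_closed N"
  show "cond_v G M" unfolding cond_v_def
  proof (intro ballI impI)
    fix a b assume a: "a \<in> carrier G" and sf: "b \<in> square_free G"
      and dv: "\<exists>n::nat. 1 \<le> n \<and> a divides b [^] n" and m: "a \<otimes> b \<in> M"
    note b = square_freeD[OF sf]
    obtain n :: nat where "a divides b [^] n" using dv by blast
    then have "multiplicity a x \<le> n * multiplicity b x" for x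
      using a b(1) by (simp add: divides_iff_multiplicity multiplicity_pow)
    then have supp: "multiplicity b x = 0 \<Longrightarrow> multiplicity a x = 0" for x
      by (metis le_zero_eq mult_0_right)
    have "level 1 (multiplicity (a \<otimes> b)) x = multiplicity b x"
      "multiplicity (a \<otimes> b) x - 1 = multiplicity a x" for x
      using a b(1) b(2)[of x] supp[of x]
      by (cases "multiplicity b x = 0"; simp add: multiplicity_mult level_def)+
    then have "level 1 (multiplicity (a \<otimes> b)) = multiplicity b"
      "(\<lambda>x. multiplicity (a \<otimes> b) x - 1) = multiplicity a" by blast+
    moreover have "level 1 (multiplicity (a \<otimes> b)) \<in> N \<and>
        (\<lambda>x. multiplicity (a \<otimes> b) x - 1) \<in> N"
      using P imageI[OF m] unfolding peel_closed_def by (rule bspec)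
    ultimately have "multiplicity b \<in> N" "multiplicity a \<in> N" by simp_all
    then show "a \<in> M \<and> b \<in> M" using a b(1) by (simp add: mem_iff_multiplicity)
  qed
qed

end

theorem theorem4p3:
  fixes H :: "('a, 'b) monoid_scheme" and M :: "'a set"
  assumes "factorial_monoid H"
    and "submonoid M H"
    and "Units (H\<lparr>carrier := M\<rparr>) = Units H"
  shows "(cond_i H M \<longleftrightarrow> cond_ii H M) \<and>
         (cond_ii H M \<longleftrightarrow> cond_iii H M) \<and>
         (cond_iii H M \<longleftrightarrow> cond_iv H M) \<and>
         (cond_iv H M \<longleftrightarrow> cond_v H M)"
proof -
  \<comment> \<open>Units of the restricted structure lie in its carrier \<open>M\<close> by
    definition.\<close>
  have "Units H \<subseteq> M"
    using assms(3) by (auto simp: Units_def)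
  then interpret factorial_monoid_submonoid H M
    using assms by (simp add: factorial_monoid_submonoid_def factorial_monoid_submonoid_axioms_def)
  show ?thesis
    by (simp add: cond_i_iff cond_ii_iff cond_iii_iff cond_iv_iff cond_v_iff
        N.half_closed_iff_level_closed N.level_closed_iff_peel_closed)
qed

end
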